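(* Let $X$ be a $\lambda$-synchronizing subshift over a finite alphabet $\Sigma$. Then $\mathfrak L^{\lambda(X)}=(V^{\lambda(X)},E^{\lambda(X)},\lambda^{\lambda(X)},\iota^{\lambda(X)})$, as defined in the context, is a $\lambda$-graph system over $\Sigma$ that presents $X$.
   Context: A subshift is a closed shift-invariant $X\subset\Sigma^{\mathbb Z}$. $\mathcal L(X)$ is the set of (nonempty) finite words appearing in points of $X$, $\mathcal L_n(X)$ those of length $n$. $\Gamma^+(a)=\{c\in\mathcal L(X): ac\in\mathcal L(X)\}$, $\Gamma^-_l(a)=\{c\in\mathcal L_l(X): ca\in\mathcal L(X)\}$, $\omega^-_l(a)=\bigcap_{c\in\Gamma^+(a)}\{b\in\mathcal L_l(X): bac\in\mathcal L(X)\}$. A word $v\in\mathcal L(X)$ is $l$-synchronizing if $\Gamma^-_l(v)\subset\omega^-_l(v)$; $\mathcal S_l(X)$ is the set of these words. $X$ is $\lambda$-synchronizing if for all $w\in\mathcal L(X)$, $k\in\mathbb N$ there is $v\in\mathcal S_k(X)\cap\Gamma^+(w)$. Words $\mu,\nu\in\mathcal L(X)$ are $l$-past equivalent if $\Gamma^-_l(\mu)=\Gamma^-_l(\nu)$; $[\mu]_l$ denotes the $l$-past equivalence class of $\mu\in\mathcal S_l(X)$. By convention $\mathcal S_0(X)=\mathcal L(X)$ and all words are $0$-past equivalent. A $\lambda$-graph system $\mathfrak L=(V,E,\lambda,\iota)$ over $\Sigma$ consists of a vertex set $V=V_0\cup V_1\cup\cdots$ (disjoint, each $V_l$ finite), an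 edge set $E=E_{0,1}\cup E_{1,2}\cup\cdots$ (each finite), where each $e\in E_{l,l+1}$ has source $s(e)\in V_l$, terminal $t(e)\in V_{l+1}$ and label $\lambda(e)\in\Sigma$, and surjections $\iota=\iota_{l,l+1}:V_{l+1}\to V_l$ for $l\in\mathbb Z_+$, such that for all $l\geq1$: (a) for $v\in V_{l+1}$ and $\alpha\in\Sigma$ there is an edge in $E_{l,l+1}$ with label $\alpha$ and terminal $v$ if and only if there is an edge in $E_{l-1,l}$ with label $\alpha$ and terminal $\iota(v)$; (b) (local property) for $u\in V_{l-1}$, $v\in V_{l+1}$ there is a label-preserving bijection between $\{e\in E_{l,l+1}: t(e)=v,\ \iota(s(e))=u\}$ and $\{e\in E_{l-1,l}: s(e)=u,\ t(e)=\iota(v)\}$. $\mathfrak L$ presents $X$ if $\mathcal L(X)$ coincides with the set of label sequences of finite paths $e_1e_2\cdots e_n$ ($t(e_i)=s(e_{i+1})$) in $\mathfrak L$. Definition of $\mathfrak L^{\lambda(X)}$: $V_l^{\lambda(X)}=\{[\mu]_l:\mu\in\mathcal S_l(X)\}$, $l\in\mathbb Z_+$. For $\nu\in\mathcal S_{l+1}(X)$ and $\alpha\in\Gamma^-_1(\nu)$ there is an edge labeled $\alpha$ from $[\alpha\nu]_l\in V_l^{\lambda(X)}$ to $[\nu]_{l+1}\in V_{l+1}^{\lambda(X)}$ (one edge per triple (source, label, terminal)); $E^{\lambda(X)}_{l,l+1}$ is the set of these edges. Since $\mathcal S_{l+1}(X)\subset\mathcal S_l(X)$, $\iota^{\lambda(X)}_{l,l+1}([\mu]_{l+1})=[\mu]_l$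 defines a map $V_{l+1}^{\lambda(X)}\to V_l^{\lambda(X)}$. *)

theory Defs
  imports "HOL-Analysis.Analysis"
begin

section \<open>Subshifts and synchronizing words\<close>

definition shift :: "(int \<Rightarrow> 'a) \<Rightarrow> int \<Rightarrow> 'a" where
  "shift x = (\<lambda>i. x (i + 1))"

definition subshift :: "'a set \<Rightarrow> (int \<Rightarrow> 'a) set \<Rightarrow> bool" where
  "subshift \<Sigma> X \<longleftrightarrow>
     closedin (product_topology (\<lambda>_::int. discrete_topology \<Sigma>) UNIV) X \<and> shift ` X = X"

definition language :: "(int \<Rightarrow> 'a) set \<Rightarrow> 'a list set" where
  "language X =
     {w. w \<noteq> [] \<and> (\<exists>x\<in>X. \<exists>i. w = map (\<lambda>k. x (i + int k)) [0..<length w])}"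

definition language_n :: "(int \<Rightarrow> 'a) set \<Rightarrow> nat \<Rightarrow> 'a list set" where
  "language_n X n = {w \<in> language X. length w = n}"

definition gamma_plus :: "(int \<Rightarrow> 'a) set \<Rightarrow> 'a list \<Rightarrow> 'a list set" where
  "gamma_plus X a = {c \<in> language X. a @ c \<in> language X}"

definition gamma_minus :: "(int \<Rightarrow> 'a) set \<Rightarrow> nat \<Rightarrow> 'a list \<Rightarrow> 'a list set" where
  "gamma_minus X l a = {c \<in> language_n X l. c @ a \<in> language X}"

definition omega_minus :: "(int \<Rightarrow> 'a) set \<Rightarrow> nat \<Rightarrow> 'a list \<Rightarrow> 'a list set" where
  "omega_minus X l a = (\<Inter>c\<in>gamma_plus X a. {b \<in> language_n X l. b @ a @ c \<in> language X})"

definition sync_words :: "(int \<Rightarrow> 'a) set \<Rightarrow> nat \<Rightarrow> 'a list set" where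
  "sync_words X l = {v \<in> language X. gamma_minus X l v \<subseteq> omega_minus X l v}"

definition lambda_synchronizing :: "(int \<Rightarrow> 'a) set \<Rightarrow> bool" where
  "lambda_synchronizing X \<longleftrightarrow>
     (\<forall>w\<in>language X. \<forall>k. sync_words X k \<inter> gamma_plus X w \<noteq> {})"

definition past_equiv :: "(int \<Rightarrow> 'a) set \<Rightarrow> nat \<Rightarrow> 'a list \<Rightarrow> 'a list \<Rightarrow> bool" where
  "past_equiv X l \<mu> \<nu> \<longleftrightarrow> gamma_minus X l \<mu> = gamma_minus X l \<nu>"

definition past_class :: "(int \<Rightarrow> 'a) set \<Rightarrow> nat \<Rightarrow> 'a list \<Rightarrow> 'a list set" where
  "past_class X l \<mu> = {\<nu> \<in> sync_words X l. past_equiv X l \<mu> \<nu>}"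

text \<open>Words are nonempty, so there are no words of length 0 and the usual conventions for
  level 0 (every word is 0-synchronizing, all words are 0-past equivalent) hold automatically.\<close>

lemma gamma_minus_0: "gamma_minus X 0 \<mu> = {}"
  by (auto simp: gamma_minus_def language_n_def language_def)

lemma sync_words_0: "sync_words X 0 = language X"
  by (simp add: sync_words_def gamma_minus_0)

lemma past_equiv_0: "past_equiv X 0 \<mu> \<nu>"
  by (simp add: past_equiv_def gamma_minus_0)


section \<open>Lambda-graph systems\<close>

text \<open>\<open>edges G l\<close> is the set of edges from level \<open>l\<close> to level \<open>l + 1\<close>, and \<open>iota G l\<close> is the
  map from level \<open>l + 1\<close> to level \<open>l\<close>.\<close>

record ('v, 'e, 'a) lambda_graph =
  verts :: "nat \<Rightarrow> 'v set"
  edges :: "nat \<Rightarrow> 'e set"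
  src :: "'e \<Rightarrow> 'v"
  trm :: "'e \<Rightarrow> 'v"
  lab :: "'e \<Rightarrow> 'a"
  iota :: "nat \<Rightarrow> 'v \<Rightarrow> 'v"

definition lambda_graph_system :: "'a set \<Rightarrow> ('v, 'e, 'a) lambda_graph \<Rightarrow> bool" where
  "lambda_graph_system \<Sigma> G \<longleftrightarrow>
     disjoint_family (verts G) \<and>
     (\<forall>l. finite (verts G l)) \<and>
     (\<forall>l. finite (edges G l)) \<and>
     (\<forall>l. \<forall>e\<in>edges G l. src G e \<in> verts G l \<and> trm G e \<in> verts G (l + 1) \<and> lab G e \<in> \<Sigma>) \<and>
     (\<forall>l. iota G l ` verts G (l + 1) = verts G l) \<and>
     (\<forall>l\<ge>1. \<forall>v\<in>verts G (l + 1). \<forall>\<alpha>\<in>\<Sigma>.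
        (\<exists>e\<in>edges G l. lab G e = \<alpha> \<and> trm G e = v) \<longleftrightarrow>
        (\<exists>e\<in>edges G (l - 1). lab G e = \<alpha> \<and> trm G e = iota G l v)) \<and>
     (\<forall>l\<ge>1. \<forall>u\<in>verts G (l - 1). \<forall>v\<in>verts G (l + 1).
        \<exists>f. bij_betw f
              {e \<in> edges G l. trm G e = v \<and> iota G (l - 1) (src G e) = u}
              {e \<in> edges G (l - 1). src G e = u \<and> trm G e = iota G l v} \<and>
            (\<forall>e\<in>{e \<in> edges G l. trm G e = v \<and> iota G (l - 1) (src G e) = u}.
               lab G (f e) = lab G e))"

definition finite_path :: "('v, 'e, 'a) lambda_graph \<Rightarrow> 'e list \<Rightarrow> bool" where
  "finite_path G es \<longleftrightarrow>
     es \<noteq> [] \<and> set es \<subseteq> (\<Union>l. edges G l) \<and> successively (\<lambda>e e'. trm G e = src G e') es"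

definition presents :: "('v, 'e, 'a) lambda_graph \<Rightarrow> (int \<Rightarrow> 'a) set \<Rightarrow> bool" where
  "presents G X \<longleftrightarrow> language X = {map (lab G) es |es. finite_path G es}"


section \<open>The lambda-graph system of a lambda-synchronizing subshift\<close>

text \<open>A class is tagged with its level because the same set of words may be a past equivalence
  class at several levels, whereas the vertex sets of different levels must be disjoint.\<close>

definition vertex :: "(int \<Rightarrow> 'a) set \<Rightarrow> nat \<Rightarrow> 'a list \<Rightarrow> nat \<times> 'a list set" where
  "vertex X l \<mu> = (l, past_class X l \<mu>)"

text \<open>An edge is the triple of its source, label and terminal. The union in \<open>iota\<close> ranges over
  all representatives of a class; \<open>iota_sync_lambda_graph\<close> below computes it on any
  representative.\<close>

definition sync_lambda_graph ::
    "(int \<Rightarrow> 'a) set \<Rightarrow>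
     (nat \<times> 'a list set, (nat \<times> 'a list set) \<times> 'a \<times> (nat \<times> 'a list set), 'a) lambda_graph" where
  "sync_lambda_graph X =
    \<lparr>verts = (\<lambda>l. {vertex X l \<mu> |\<mu>. \<mu> \<in> sync_words X l}),
     edges = (\<lambda>l. {(vertex X l (\<alpha> # \<nu>), \<alpha>, vertex X (l + 1) \<nu>) |\<alpha> \<nu>.
                     \<nu> \<in> sync_words X (l + 1) \<and> [\<alpha>] \<in> gamma_minus X 1 \<nu>}),
     src = (\<lambda>(u, \<alpha>, v). u),
     trm = (\<lambda>(u, \<alpha>, v). v),
     lab = (\<lambda>(u, \<alpha>, v). \<alpha>),
     iota = (\<lambda>l (m, C). (l, \<Union>\<mu>\<in>C. past_class X l \<mu>))\<rparr>"

lemma languageI: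
  assumes "w \<noteq> []" "x \<in> X" "w = map (\<lambda>k. x (i + int k)) [0..<length w]"
  shows "w \<in> language X"
  using assms unfolding language_def mem_Collect_eq by blast

lemma language_extend_left:
  assumes "w \<in> language X"
  obtains a where "a # w \<in> language X"
proof -
  from assms obtain x i where x: "x \<in> X" and w: "w = map (\<lambda>k. x (i + int k)) [0..<length w]"
    by (auto simp: language_def)
  have "x (i - 1) # w = map (\<lambda>k. x ((i - 1) + int k)) [0..<length (x (i - 1) # w)]"
    by (subst w) (rule nth_equalityI, auto simp: nth_Cons algebra_simps simp del: upt_Suc split: nat.split)
  from languageI[OF _ x this] have "x (i - 1) # w \<in> language X"
    by blast
  then show ?thesis by (rule that)
qed

lemma language_prefix:
  assumes "u @ w \<in> language X" "u \<noteq> []"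
  shows "u \<in> language X"
proof -
  from assms obtain x i where x: "x \<in> X"
    and uw: "u @ w = map (\<lambda>k. x (i + int k)) [0..<length (u @ w)]"
    by (auto simp: language_def)
  have "u = take (length u) (map (\<lambda>k. x (i + int k)) [0..<length (u @ w)])"
    by (subst uw[symmetric]) simp
  then have "u = map (\<lambda>k. x (i + int k)) [0..<length u]"
    by (simp add: take_map)
  from languageI[OF assms(2) x this] show ?thesis .
qed

lemma language_tail:
  assumes "a # w \<in> language X" "w \<noteq> []"
  shows "w \<in> language X"
proof -
  from assms obtain x i where x: "x \<in> X"
    and aw: "a # w = map (\<lambda>k. x (i + int k)) [0..<length (a # w)]"
    by (auto simp: language_def)
  have "w = map (\<lambda>k. x (i + 1 + int k)) [0..<length w]"
  proof (rule nth_equalityI)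
    fix j assume j: "j < length w"
    have "w ! j = (a # w) ! Suc j" by simp
    also have "\<dots> = x (i + int (Suc j))"
      by (subst aw) (use j in \<open>simp del: upt_Suc\<close>)
    finally show "w ! j = map (\<lambda>k. x (i + 1 + int k)) [0..<length w] ! j"
      using j by (simp add: algebra_simps)
  qed simp
  from languageI[OF assms(2) x this] show ?thesis .
qed

lemma past_equiv_mono:
  assumes "past_equiv X (l + 1) \<mu> \<nu>"
  shows "past_equiv X l \<mu> \<nu>"
proof -
  have *: "b \<in> gamma_minus X l \<rho> \<longleftrightarrow>
      b \<noteq> [] \<and> (\<exists>a. a # b \<in> gamma_minus X (l + 1) \<rho>)" for b \<rho>
  proof
    assume b: "b \<in> gamma_minus X l \<rho>"
    then have bL: "b \<in> language X" "length b = l" "b @ \<rho> \<in> language X"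
      by (auto simp: gamma_minus_def language_n_def)
    from language_extend_left[OF bL(3)] obtain a where a: "a # b @ \<rho> \<in> language X" .
    moreover have "a # b \<in> language X"
      using language_prefix[of "a # b" \<rho> X] a by simp
    ultimately show "b \<noteq> [] \<and> (\<exists>a. a # b \<in> gamma_minus X (l + 1) \<rho>)"
      using bL by (auto simp: gamma_minus_def language_n_def language_def[of X])
  next
    assume "b \<noteq> [] \<and> (\<exists>a. a # b \<in> gamma_minus X (l + 1) \<rho>)"
    then show "b \<in> gamma_minus X l \<rho>"
      by (auto simp: gamma_minus_def language_n_def intro: language_tail)
  qed
  show ?thesis
    using assms * unfolding past_equiv_def by blast
qed

lemma iota_sync_lambda_graph:
  assumes "\<mu> \<in> sync_words X (l + 1)"
  shows "iota (sync_lambda_graph X) l (vertex X (l + 1) \<mu>) = vertex X l \<mu>"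
proof -
  have mem: "\<mu> \<in> past_class X (l + 1) \<mu>"
    using assms by (simp add: past_class_def past_equiv_def)
  have "past_class X l \<nu> = past_class X l \<mu>" if "\<nu> \<in> past_class X (l + 1) \<mu>" for \<nu>
    using that past_equiv_mono[of X l \<mu> \<nu>]
    by (auto simp: past_class_def past_equiv_def)
  with mem have "(\<Union>\<nu>\<in>past_class X (l + 1) \<mu>. past_class X l \<nu>) = past_class X l \<mu>"
    by blast
  then show ?thesis
    by (simp add: sync_lambda_graph_def vertex_def)
qed

end

theory Submission
  imports Defs
begin

text \<open>Words can be moved between levels: prepending a word of length \<open>m\<close> to an
  \<open>(l + m)\<close>-synchronizing word gives an \<open>l\<close>-synchronizing word whose \<open>l\<close>-past class depends only
  on the \<open>(l + m)\<close>-past class of the original word. Hence every edge is determined by its label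
  and its terminal, and the labels of the edges ending in \<open>[\<nu>]\<close> are the letters that may precede
  \<open>\<nu>\<close>; conditions (a) and (b) follow by comparing labels. Surjectivity of \<open>\<iota>\<close> is where
  \<open>\<lambda>\<close>-synchronization enters: an \<open>l\<close>-synchronizing \<open>\<mu>\<close> has the same \<open>l\<close>-past as \<open>\<mu>v\<close>, and \<open>\<mu>v\<close> is
  \<open>(l + 1)\<close>-synchronizing once \<open>v\<close> is \<open>(l + 1 + |\<mu>|)\<close>-synchronizing.\<close>

section \<open>Words of the language\<close>

lemma language_nonempty: "w \<in> language X \<Longrightarrow> w \<noteq> []"
  by (simp add: language_def)

lemma language_suffix:
  assumes "u @ w \<in> language X" "w \<noteq> []"
  shows "w \<in> language X"
  using assms(1) by (induction u) (use assms(2) in \<open>auto intro: language_tail\<close>)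

text \<open>A closed set lies in the topspace of the product topology, so every coordinate of a
  point is a letter of \<open>\<Sigma>\<close>.\<close>

lemma language_alphabet:
  assumes "subshift \<Sigma> X" "w \<in> language X"
  shows "set w \<subseteq> \<Sigma>"
proof -
  from assms(2) obtain x i where x: "x \<in> X" and w: "w = map (\<lambda>k. x (i + int k)) [0..<length w]"
    by (auto simp: language_def)
  have "X \<subseteq> topspace (product_topology (\<lambda>_::int. discrete_topology \<Sigma>) UNIV)"
    using assms(1) closedin_subset unfolding subshift_def by blast
  with x have "x j \<in> \<Sigma>" for j
    by (auto simp: PiE_iff)
  then show ?thesis
    by (subst w) auto
qed

section \<open>Pasts and synchronizing words\<close>

lemma gamma_minus_iff:
  "b \<in> gamma_minus X l \<mu> \<longleftrightarrow> b \<noteq> [] \<and> length b = l \<and> b @ \<mu> \<in> language X"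
  by (auto simp: gamma_minus_def language_n_def dest: language_nonempty language_prefix)

lemma gamma_minus_1_iff: "[\<alpha>] \<in> gamma_minus X 1 \<mu> \<longleftrightarrow> \<alpha> # \<mu> \<in> language X"
  by (simp add: gamma_minus_iff)

lemma sync_words_language: "\<mu> \<in> sync_words X l \<Longrightarrow> \<mu> \<in> language X"
  by (simp add: sync_words_def)

text \<open>Unfolds the intersection in \<open>omega_minus\<close> into a gluing rule at
  \<open>v\<close>: a left and a right extension can be combined. Allowing \<open>c = []\<close> is
  harmless and spares case distinctions later.\<close>

lemma sync_words_iff:
  "v \<in> sync_words X l \<longleftrightarrow> v \<in> language X \<and>
     (\<forall>b c. b \<noteq> [] \<longrightarrow> length b = l \<longrightarrow> b @ v \<in> language X \<longrightarrow> v @ c \<in> language X \<longrightarrow>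
        b @ v @ c \<in> language X)"
  (is "_ \<longleftrightarrow> _ \<and> ?R")
proof -
  have "gamma_minus X l v \<subseteq> omega_minus X l v \<longleftrightarrow> ?R"
  proof
    assume sub: "gamma_minus X l v \<subseteq> omega_minus X l v"
    show ?R
    proof (intro allI impI)
      fix b c
      assume b: "b \<noteq> []" "length b = l" "b @ v \<in> language X" and c: "v @ c \<in> language X"
      show "b @ v @ c \<in> language X"
      proof (cases "c = []")
        case False
        with c have "c \<in> gamma_plus X v"
          by (auto simp: gamma_plus_def intro: language_suffix)
        moreover from b sub have "b \<in> omega_minus X l v"
          by (auto simp: gamma_minus_iff)
        ultimately show ?thesis
          by (auto simp: omega_minus_def)
      qed (use b in simp)
    qed
  next
    assume R: ?R
    show "gamma_minus X l v \<subseteq> omega_minus X l v"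
    proof
      fix b assume b: "b \<in> gamma_minus X l v"
      then have "b \<in> language_n X l"
        by (simp add: gamma_minus_def)
      with b R show "b \<in> omega_minus X l v"
        by (auto simp: omega_minus_def gamma_plus_def gamma_minus_iff)
    qed
  qed
  then show ?thesis
    by (simp add: sync_words_def)
qed

text \<open>A left extension of \<open>w @ v\<close> by \<open>l\<close> letters extends
  \<open>v\<close> by \<open>l + length w\<close> letters, so gluing at \<open>v\<close>
  applies.\<close>

lemma sync_words_append:
  assumes "v \<in> sync_words X (l + length w)" "w @ v \<in> language X"
  shows "w @ v \<in> sync_words X l"
  unfolding sync_words_iff
proof (intro conjI allI impI)
  fix b c
  assume b: "b \<noteq> []" "length b = l" "b @ w @ v \<in> language X" and c: "(w @ v) @ c \<in> language X"
  have "v @ c \<in> language X"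
    using language_suffix[of w "v @ c"] c sync_words_language[OF assms(1)]
    by (auto dest: language_nonempty)
  moreover have "(b @ w) @ v \<in> language X" "b @ w \<noteq> []" "length (b @ w) = l + length w"
    using b by auto
  ultimately have "(b @ w) @ v @ c \<in> language X"
    using assms(1) unfolding sync_words_iff by blast
  then show "b @ (w @ v) @ c \<in> language X"
    by simp
qed (fact assms(2))

text \<open>Extend \<open>b\<close> by one letter to the left, glue, then drop that letter.\<close>

lemma sync_words_Suc_subset: "sync_words X (Suc l) \<subseteq> sync_words X l"
proof
  fix v assume v: "v \<in> sync_words X (Suc l)"
  show "v \<in> sync_words X l"
    unfolding sync_words_iff
  proof (intro conjI allI impI)
    fix b c
    assume b: "b \<noteq> []" "length b = l" "b @ v \<in> language X" and c: "v @ c \<in> language X"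
    from language_extend_left[OF b(3)] obtain a where "(a # b) @ v \<in> language X"
      by auto
    moreover have "a # b \<noteq> []" "length (a # b) = Suc l"
      using b by auto
    ultimately have "(a # b) @ v @ c \<in> language X"
      using v c unfolding sync_words_iff by blast
    then show "b @ v @ c \<in> language X"
      using b(1) by (auto intro: language_tail)
  qed (use v sync_words_language in blast)
qed

section \<open>Past equivalence and equality of vertices\<close>

lemma past_equiv_antimono:
  assumes "m \<le> l" "past_equiv X l \<mu> \<nu>"
  shows "past_equiv X m \<mu> \<nu>"
  using assms by (induction rule: inc_induct) (auto intro: past_equiv_mono)

text \<open>Appending \<open>\<alpha>\<close> turns an \<open>l\<close>-past of
  \<open>\<alpha> # \<rho>\<close> into a \<open>Suc l\<close>-past of
  \<open>\<rho>\<close>.\<close>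

lemma past_equiv_Cons:
  assumes "past_equiv X (Suc l) \<mu> \<nu>"
  shows "past_equiv X l (\<alpha> # \<mu>) (\<alpha> # \<nu>)"
proof -
  have "b \<in> gamma_minus X l (\<alpha> # \<rho>) \<longleftrightarrow> b \<noteq> [] \<and> b @ [\<alpha>] \<in> gamma_minus X (Suc l) \<rho>" for b \<rho>
    by (auto simp: gamma_minus_iff)
  then show ?thesis
    using assms unfolding past_equiv_def by blast
qed

text \<open>Since \<open>Suc l\<close> is at least 1, the pasts determine which single letters may
  precede.\<close>

lemma past_equiv_Cons_language:
  assumes "past_equiv X (Suc l) \<mu> \<nu>"
  shows "\<alpha> # \<mu> \<in> language X \<longleftrightarrow> \<alpha> # \<nu> \<in> language X"
  using past_equiv_antimono[OF _ assms, of 1]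
  unfolding past_equiv_def by (metis gamma_minus_1_iff le_add1 plus_1_eq_Suc)

text \<open>One synchronizing representative suffices: \<open>\<mu>\<close> lies in its own class,
  hence in that of \<open>\<nu>\<close> when the classes agree. The level tag gives
  \<open>l = m\<close>.\<close>

lemma vertex_eq_iff:
  assumes "\<mu> \<in> sync_words X l"
  shows "vertex X l \<mu> = vertex X m \<nu> \<longleftrightarrow> l = m \<and> past_equiv X l \<mu> \<nu>"
proof -
  have "past_class X l \<mu> = past_class X l \<nu> \<longleftrightarrow> past_equiv X l \<mu> \<nu>"
  proof
    assume "past_class X l \<mu> = past_class X l \<nu>"
    with assms have "\<mu> \<in> past_class X l \<nu>"
      by (auto simp: past_class_def past_equiv_def)
    then show "past_equiv X l \<mu> \<nu>"
      by (simp add: past_class_def past_equiv_def)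
  qed (simp add: past_class_def past_equiv_def)
  then show ?thesis
    by (auto simp: vertex_def)
qed

section \<open>Edges with a given terminal\<close>

lemma sync_lambda_graph_simps:
  "verts (sync_lambda_graph X) l = vertex X l ` sync_words X l"
  "src (sync_lambda_graph X) e = fst e"
  "lab (sync_lambda_graph X) e = fst (snd e)"
  "trm (sync_lambda_graph X) e = snd (snd e)"
  by (auto simp: sync_lambda_graph_def split: prod.split)

lemma edges_sync_lambda_graph:
  "edges (sync_lambda_graph X) l =
     {(vertex X l (\<alpha> # \<nu>), \<alpha>, vertex X (Suc l) \<nu>) |\<alpha> \<nu>.
        \<nu> \<in> sync_words X (Suc l) \<and> \<alpha> # \<nu> \<in> language X}"
  by (simp add: sync_lambda_graph_def gamma_minus_1_iff[unfolded One_nat_def])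

text \<open>The edge may come from another representative \<open>\<nu>'\<close> of its terminal;
  past equivalence at level \<open>Suc l\<close> carries both the admissibility of
  \<open>\<alpha>\<close> and the \<open>l\<close>-past of \<open>\<alpha> # \<nu>'\<close> over to
  \<open>\<nu>\<close>.\<close>

lemma edge_to_vertex_iff:
  assumes "\<nu> \<in> sync_words X (Suc l)"
  shows "(u, \<alpha>, vertex X (Suc l) \<nu>) \<in> edges (sync_lambda_graph X) l \<longleftrightarrow>
    \<alpha> # \<nu> \<in> language X \<and> u = vertex X l (\<alpha> # \<nu>)"
proof
  assume "(u, \<alpha>, vertex X (Suc l) \<nu>) \<in> edges (sync_lambda_graph X) l"
  then obtain \<nu>' where \<nu>': "\<nu>' \<in> sync_words X (Suc l)" "\<alpha> # \<nu>' \<in> language X"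
    and u: "u = vertex X l (\<alpha> # \<nu>')" and "vertex X (Suc l) \<nu> = vertex X (Suc l) \<nu>'"
    by (auto simp: edges_sync_lambda_graph)
  then have eq: "past_equiv X (Suc l) \<nu> \<nu>'"
    using vertex_eq_iff[OF assms] by blast
  have L: "\<alpha> # \<nu> \<in> language X"
    using past_equiv_Cons_language[OF eq] \<nu>'(2) by blast
  moreover have "\<alpha> # \<nu> \<in> sync_words X l"
    using sync_words_append[of \<nu> X l "[\<alpha>]"] assms L by simp
  ultimately show "\<alpha> # \<nu> \<in> language X \<and> u = vertex X l (\<alpha> # \<nu>)"
    using past_equiv_Cons[OF eq] u vertex_eq_iff by metis
qed (use assms in \<open>auto simp: edges_sync_lambda_graph\<close>)

text \<open>The system is left-resolving: edges with a common terminal are indexed by their labels.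
  Conditions (a) and (b) are both read off from this.\<close>

lemma edges_into_vertex:
  assumes "\<nu> \<in> sync_words X (Suc l)"
  shows "{e \<in> edges (sync_lambda_graph X) l. trm (sync_lambda_graph X) e = vertex X (Suc l) \<nu>} =
    (\<lambda>\<alpha>. (vertex X l (\<alpha> # \<nu>), \<alpha>, vertex X (Suc l) \<nu>)) ` {\<alpha>. \<alpha> # \<nu> \<in> language X}"
  (is "?L = ?R")
proof
  show "?L \<subseteq> ?R"
  proof
    fix e assume e: "e \<in> ?L"
    then have "e = (fst e, fst (snd e), vertex X (Suc l) \<nu>)"
      by (simp add: sync_lambda_graph_simps prod_eq_iff)
    with e show "e \<in> ?R"
      using edge_to_vertex_iff[OF assms, of "fst e" "fst (snd e)"] by auto
  qed
  show "?R \<subseteq> ?L"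
    using edge_to_vertex_iff[OF assms] by (simp add: image_subset_iff sync_lambda_graph_simps)
qed

lemma in_label_iff:
  assumes "\<nu> \<in> sync_words X (Suc l)"
  shows "(\<exists>e\<in>edges (sync_lambda_graph X) l.
      lab (sync_lambda_graph X) e = \<alpha> \<and> trm (sync_lambda_graph X) e = vertex X (Suc l) \<nu>) \<longleftrightarrow>
    \<alpha> # \<nu> \<in> language X" (is "?L \<longleftrightarrow> _")
proof -
  have "?L \<longleftrightarrow> \<alpha> \<in> lab (sync_lambda_graph X) `
      {e \<in> edges (sync_lambda_graph X) l. trm (sync_lambda_graph X) e = vertex X (Suc l) \<nu>}"
    by blast
  then show ?thesis
    unfolding edges_into_vertex[OF assms] by (simp add: image_image sync_lambda_graph_simps)
qed

section \<open>Axioms of a \<open>\<lambda>\<close>-graph system\<close>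

text \<open>A class is determined by its past, a subset of the finitely many words of length
  \<open>l\<close> over \<open>\<Sigma>\<close>.\<close>

lemma finite_verts_sync_lambda_graph:
  assumes "finite \<Sigma>" "subshift \<Sigma> X"
  shows "finite (verts (sync_lambda_graph X) l)"
proof -
  have "gamma_minus X l \<mu> \<subseteq> {b. set b \<subseteq> \<Sigma> \<and> length b = l}" for \<mu>
    using language_alphabet[OF assms(2)] by (auto simp: gamma_minus_def language_n_def)
  then have "gamma_minus X l ` sync_words X l \<subseteq> Pow {b. set b \<subseteq> \<Sigma> \<and> length b = l}"
    by blast
  then have "finite (gamma_minus X l ` sync_words X l)"
    by (rule finite_subset) (simp add: finite_lists_length_eq assms(1))
  moreover have "vertex X l \<mu> = (l, {\<nu> \<in> sync_words X l. gamma_minus X l \<nu> = gamma_minus X l \<mu>})" for \<mu>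
    by (auto simp: vertex_def past_class_def past_equiv_def)
  then have "verts (sync_lambda_graph X) l =
      (\<lambda>P. (l, {\<nu> \<in> sync_words X l. gamma_minus X l \<nu> = P})) ` gamma_minus X l ` sync_words X l"
    by (simp add: sync_lambda_graph_simps image_image)
  ultimately show ?thesis
    by simp
qed

text \<open>Besides locating sources, labels and terminals, this bounds the edge set by a product of
  finite sets.\<close>

lemma edge_sync_lambda_graph_in:
  assumes "subshift \<Sigma> X" "e \<in> edges (sync_lambda_graph X) l"
  shows "e \<in> verts (sync_lambda_graph X) l \<times> \<Sigma> \<times> verts (sync_lambda_graph X) (Suc l)"
proof -
  from assms(2) obtain \<alpha> \<nu> where e: "e = (vertex X l (\<alpha> # \<nu>), \<alpha>, vertex X (Suc l) \<nu>)"
    and \<nu>: "\<nu> \<in> sync_words X (Suc l)" "\<alpha> # \<nu> \<in> language X"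
    by (auto simp: edges_sync_lambda_graph)
  have "\<alpha> # \<nu> \<in> sync_words X l"
    using sync_words_append[of \<nu> X l "[\<alpha>]"] \<nu> by simp
  moreover have "\<alpha> \<in> \<Sigma>"
    using language_alphabet[OF assms(1) \<nu>(2)] by simp
  ultimately show ?thesis
    using \<nu>(1) by (auto simp: e sync_lambda_graph_simps)
qed

lemma iota_sync_lambda_graph_surj:
  assumes "lambda_synchronizing X"
  shows "iota (sync_lambda_graph X) l ` verts (sync_lambda_graph X) (Suc l) =
    verts (sync_lambda_graph X) l"
proof -
  have "vertex X l ` sync_words X l \<subseteq> vertex X l ` sync_words X (Suc l)"
  proof
    fix x assume "x \<in> vertex X l ` sync_words X l"
    then obtain \<mu> where \<mu>: "\<mu> \<in> sync_words X l" and x: "x = vertex X l \<mu>"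
      by blast
    \<comment> \<open>Prepending \<open>\<mu>\<close> costs \<open>length \<mu>\<close> levels; the
      surplus leaves \<open>\<mu> @ v\<close> synchronizing at level \<open>Suc l\<close>.\<close>
    obtain v where v: "v \<in> sync_words X (Suc l + length \<mu>)" "v \<in> gamma_plus X \<mu>"
      using assms sync_words_language[OF \<mu>] unfolding lambda_synchronizing_def by blast
    then have L: "\<mu> @ v \<in> language X"
      by (simp add: gamma_plus_def)
    with v have "\<mu> @ v \<in> sync_words X (Suc l)"
      by (intro sync_words_append)
    \<comment> \<open>One inclusion is gluing at the \<open>l\<close>-synchronizing word
      \<open>\<mu>\<close>, the other is passage to prefixes.\<close>
    moreover have "gamma_minus X l \<mu> = gamma_minus X l (\<mu> @ v)"
      using \<mu> L language_prefix[of "_ @ \<mu>" v X]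
      by (auto simp: gamma_minus_iff sync_words_iff)
    then have "x = vertex X l (\<mu> @ v)"
      using vertex_eq_iff[OF \<mu>] by (simp add: past_equiv_def x)
    ultimately show "x \<in> vertex X l ` sync_words X (Suc l)"
      by blast
  qed
  then have "vertex X l ` sync_words X l = vertex X l ` sync_words X (Suc l)"
    using sync_words_Suc_subset by blast
  then show ?thesis
    using iota_sync_lambda_graph[of _ X l] by (simp add: sync_lambda_graph_simps image_image)
qed

text \<open>Condition (a), with the level shifted by one. The same \<open>\<nu>\<close> represents
  \<open>v\<close> and its image under \<open>iota\<close>, so both sides reduce to
  \<open>\<alpha> # \<nu>\<close> being in the language.\<close>

lemma sync_lambda_graph_in_labels:
  assumes "v \<in> verts (sync_lambda_graph X) (Suc (Suc l))"
  shows "(\<exists>e\<in>edges (sync_lambda_graph X) (Suc l).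
            lab (sync_lambda_graph X) e = \<alpha> \<and> trm (sync_lambda_graph X) e = v) \<longleftrightarrow>
         (\<exists>e\<in>edges (sync_lambda_graph X) l.
            lab (sync_lambda_graph X) e = \<alpha> \<and>
            trm (sync_lambda_graph X) e = iota (sync_lambda_graph X) (Suc l) v)"
proof -
  obtain \<nu> where \<nu>: "\<nu> \<in> sync_words X (Suc (Suc l))" and v: "v = vertex X (Suc (Suc l)) \<nu>"
    using assms by (auto simp: sync_lambda_graph_simps)
  have \<nu>': "\<nu> \<in> sync_words X (Suc l)"
    using \<nu> sync_words_Suc_subset by blast
  have iv: "iota (sync_lambda_graph X) (Suc l) v = vertex X (Suc l) \<nu>"
    using iota_sync_lambda_graph[of \<nu> X "Suc l"] \<nu> by (simp add: v)
  show ?thesis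
    unfolding iv unfolding v in_label_iff[OF \<nu>] in_label_iff[OF \<nu>'] ..
qed

text \<open>Condition (b), with the same shift: the two edge sets turn out to have the same labels,
  and within each set the label determines the edge.\<close>

lemma sync_lambda_graph_local_property:
  fixes u :: "nat \<times> 'a list set"
  assumes "v \<in> verts (sync_lambda_graph X) (Suc (Suc l))"
  defines "G \<equiv> sync_lambda_graph X"
  defines "A \<equiv> {e \<in> edges G (Suc l). trm G e = v \<and> iota G l (src G e) = u}"
  defines "B \<equiv> {e \<in> edges G l. src G e = u \<and> trm G e = iota G (Suc l) v}"
  shows "\<exists>f. bij_betw f A B \<and> (\<forall>e\<in>A. lab G (f e) = lab G e)"
proof -
  obtain \<nu> where \<nu>: "\<nu> \<in> sync_words X (Suc (Suc l))" and v: "v = vertex X (Suc (Suc l)) \<nu>"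
    using assms(1) by (auto simp: sync_lambda_graph_simps)
  have \<nu>': "\<nu> \<in> sync_words X (Suc l)"
    using \<nu> sync_words_Suc_subset by blast
  have iv: "iota G (Suc l) v = vertex X (Suc l) \<nu>"
    using iota_sync_lambda_graph[of \<nu> X "Suc l"] \<nu> by (simp add: v G_def)
  \<comment> \<open>Prepending one letter to \<open>\<nu>\<close> leaves a word synchronizing at
    level \<open>Suc l\<close>, on which \<open>iota\<close> can be computed.\<close>
  have iota_src: "iota G l (vertex X (Suc l) (\<alpha> # \<nu>)) = vertex X l (\<alpha> # \<nu>)"
    if "\<alpha> # \<nu> \<in> language X" for \<alpha>
    using iota_sync_lambda_graph[of "\<alpha> # \<nu>" X l] sync_words_append[of \<nu> X "Suc l" "[\<alpha>]"] \<nu> that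
    by (simp add: G_def)
  define S where "S = {\<alpha>. \<alpha> # \<nu> \<in> language X \<and> vertex X l (\<alpha> # \<nu>) = u}"
  have A: "A = (\<lambda>\<alpha>. (vertex X (Suc l) (\<alpha> # \<nu>), \<alpha>, v)) ` S"
  proof -
    have "A = {e \<in> {e \<in> edges G (Suc l). trm G e = v}. iota G l (src G e) = u}"
      by (auto simp: A_def)
    also have "{e \<in> edges G (Suc l). trm G e = v} =
        (\<lambda>\<alpha>. (vertex X (Suc l) (\<alpha> # \<nu>), \<alpha>, v)) ` {\<alpha>. \<alpha> # \<nu> \<in> language X}"
      unfolding v G_def by (rule edges_into_vertex[OF \<nu>])
    finally show ?thesis
      using iota_src by (auto simp: S_def sync_lambda_graph_simps(2)[of X, folded G_def])
  qed
  have B: "B = (\<lambda>\<alpha>. (u, \<alpha>, vertex X (Suc l) \<nu>)) ` S"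
  proof -
    have "B = {e \<in> {e \<in> edges G l. trm G e = vertex X (Suc l) \<nu>}. src G e = u}"
      by (auto simp: B_def iv)
    also have "{e \<in> edges G l. trm G e = vertex X (Suc l) \<nu>} =
        (\<lambda>\<alpha>. (vertex X l (\<alpha> # \<nu>), \<alpha>, vertex X (Suc l) \<nu>)) ` {\<alpha>. \<alpha> # \<nu> \<in> language X}"
      unfolding G_def by (rule edges_into_vertex[OF \<nu>'])
    also have "{e \<in> \<dots>. src G e = u} = (\<lambda>\<alpha>. (vertex X l (\<alpha> # \<nu>), \<alpha>, vertex X (Suc l) \<nu>)) ` S"
      by (simp add: Compr_image_eq S_def sync_lambda_graph_simps(2)[of X, folded G_def])
    also have "\<dots> = (\<lambda>\<alpha>. (u, \<alpha>, vertex X (Suc l) \<nu>)) ` S"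
      by (rule image_cong) (simp_all add: S_def)
    finally show ?thesis .
  qed
  \<comment> \<open>Only source and terminal are replaced; injectivity on \<open>A\<close> holds
    because the kept label determines the edge.\<close>
  let ?f = "\<lambda>e. (u, fst (snd e), vertex X (Suc l) \<nu>)"
  have "bij_betw ?f A B"
    unfolding A B bij_betw_def by (auto simp: inj_on_def image_image)
  then show ?thesis
    by (intro exI[of _ ?f]) (simp add: G_def sync_lambda_graph_simps)
qed

lemma lambda_graph_system_sync_lambda_graph:
  assumes "finite \<Sigma>" "subshift \<Sigma> X" "lambda_synchronizing X"
  shows "lambda_graph_system \<Sigma> (sync_lambda_graph X)"
proof -
  let ?G = "sync_lambda_graph X"
  have edge: "edges ?G l \<subseteq> verts ?G l \<times> \<Sigma> \<times> verts ?G (Suc l)" for l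
    using edge_sync_lambda_graph_in[OF assms(2)] by blast
  have "disjoint_family (verts ?G)"
    by (auto simp: disjoint_family_on_def sync_lambda_graph_simps vertex_def)
  moreover have fin: "finite (verts ?G l)" for l
    using finite_verts_sync_lambda_graph[OF assms(1,2)] .
  moreover have "finite (edges ?G l)" for l
    by (rule finite_subset[OF edge]) (simp add: fin assms(1))
  moreover have "src ?G e \<in> verts ?G l \<and> trm ?G e \<in> verts ?G (l + 1) \<and> lab ?G e \<in> \<Sigma>"
    if "e \<in> edges ?G l" for e l
    using edge that by (fastforce simp: sync_lambda_graph_simps(2-))
  moreover have "iota ?G l ` verts ?G (l + 1) = verts ?G l" for l
    using iota_sync_lambda_graph_surj[OF assms(3)] by simp
  moreover have "(\<exists>e\<in>edges ?G l. lab ?G e = \<alpha> \<and> trm ?G e = v) \<longleftrightarrow>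
      (\<exists>e\<in>edges ?G (l - 1). lab ?G e = \<alpha> \<and> trm ?G e = iota ?G l v)"
    if "l \<ge> 1" "v \<in> verts ?G (l + 1)" for l v \<alpha>
    using that sync_lambda_graph_in_labels[of v X "l - 1" \<alpha>] by simp
  moreover have "\<exists>f. bij_betw f
              {e \<in> edges ?G l. trm ?G e = v \<and> iota ?G (l - 1) (src ?G e) = u}
              {e \<in> edges ?G (l - 1). src ?G e = u \<and> trm ?G e = iota ?G l v} \<and>
            (\<forall>e\<in>{e \<in> edges ?G l. trm ?G e = v \<and> iota ?G (l - 1) (src ?G e) = u}.
               lab ?G (f e) = lab ?G e)"
    if "l \<ge> 1" "v \<in> verts ?G (l + 1)" for l u v
    using that sync_lambda_graph_local_property[of v X "l - 1" u] by simp
  ultimately show ?thesis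
    unfolding lambda_graph_system_def by blast
qed

section \<open>Paths and the presented language\<close>

lemma finite_path_Cons:
  "finite_path G (e # es) \<longleftrightarrow>
     e \<in> (\<Union>l. edges G l) \<and> (es = [] \<or> finite_path G es \<and> trm G e = src G (hd es))"
  by (cases es) (auto simp: finite_path_def)

text \<open>Induction from the end of the path, where \<open>\<nu>\<close> represents the last
  terminal. Tracking the source vertex allows the preceding edge to be attached.\<close>

lemma finite_path_source:
  assumes "finite_path (sync_lambda_graph X) es"
  shows "\<exists>l \<nu>. map (lab (sync_lambda_graph X)) es @ \<nu> \<in> sync_words X l \<and>
    src (sync_lambda_graph X) (hd es) = vertex X l (map (lab (sync_lambda_graph X)) es @ \<nu>)"
  using assms
proof (induction es)
  case Nil
  then show ?case
    by (simp add: finite_path_def)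
next
  case (Cons e es)
  let ?G = "sync_lambda_graph X"
  from Cons.prems obtain l where el: "e \<in> edges ?G l"
    and path: "es = [] \<or> finite_path ?G es \<and> trm ?G e = src ?G (hd es)"
    by (auto simp: finite_path_Cons)
  from el obtain \<alpha> \<nu> where e: "e = (vertex X l (\<alpha> # \<nu>), \<alpha>, vertex X (Suc l) \<nu>)"
    and \<nu>: "\<nu> \<in> sync_words X (Suc l)"
    by (auto simp: edges_sync_lambda_graph)
  have "\<exists>\<rho>. map (lab ?G) es @ \<rho> \<in> sync_words X (Suc l) \<and>
      vertex X (Suc l) \<nu> = vertex X (Suc l) (map (lab ?G) es @ \<rho>)"
  proof (cases "es = []")
    case True
    with \<nu> show ?thesis
      by auto
  next
    case False
    with path Cons.IH obtain m \<rho> where "map (lab ?G) es @ \<rho> \<in> sync_words X m"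
      and "vertex X (Suc l) \<nu> = vertex X m (map (lab ?G) es @ \<rho>)"
      by (auto simp: e sync_lambda_graph_simps(2,4))
    \<comment> \<open>The level tag of the common vertex forces \<open>m = Suc l\<close>.\<close>
    then show ?thesis
      using vertex_eq_iff[OF \<nu>] by metis
  qed
  then obtain \<rho> where \<rho>: "map (lab ?G) es @ \<rho> \<in> sync_words X (Suc l)" (is "?w \<in> _")
    and eq: "vertex X (Suc l) \<nu> = vertex X (Suc l) (map (lab ?G) es @ \<rho>)"
    by blast
  \<comment> \<open>The terminal of \<open>e\<close> is now represented by \<open>?w\<close>, so the
    remaining labels follow \<open>\<alpha>\<close> in one word.\<close>
  from el e eq have L: "\<alpha> # ?w \<in> language X \<and> vertex X l (\<alpha> # \<nu>) = vertex X l (\<alpha> # ?w)"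
    using edge_to_vertex_iff[OF \<rho>] by metis
  then have "\<alpha> # ?w \<in> sync_words X l"
    using sync_words_append[of ?w X l "[\<alpha>]"] \<rho> by simp
  moreover have "src ?G e = vertex X l (\<alpha> # \<nu>)" "lab ?G e = \<alpha>"
    by (simp_all add: e sync_lambda_graph_simps(2,3))
  ultimately show ?case
    using L by (intro exI[of _ l] exI[of _ \<rho>]) simp
qed

text \<open>The path deletes the letters of \<open>w @ v\<close> one by one, moving up a level each
  time, until the class of \<open>v\<close> is reached. The source clause chains successive
  edges.\<close>

lemma finite_path_exists:
  assumes "w \<noteq> []" "v \<in> sync_words X (l + length w)" "w @ v \<in> language X"
  shows "\<exists>es. finite_path (sync_lambda_graph X) es \<and> map (lab (sync_lambda_graph X)) es = w \<and>
    src (sync_lambda_graph X) (hd es) = vertex X l (w @ v)"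
  using assms
proof (induction w arbitrary: l)
  case (Cons a w)
  let ?G = "sync_lambda_graph X"
  let ?e = "(vertex X l (a # w @ v), a, vertex X (Suc l) (w @ v))"
  have "v \<noteq> []"
    using Cons.prems(2) sync_words_language language_nonempty by blast
  then have wv: "w @ v \<in> language X"
    using Cons.prems(3) by (auto intro: language_tail)
  then have "w @ v \<in> sync_words X (Suc l)"
    using Cons.prems(2) by (intro sync_words_append) simp_all
  then have e: "?e \<in> edges ?G l"
    using edge_to_vertex_iff Cons.prems(3) by fastforce
  show ?case
  proof (cases "w = []")
    case True
    with e show ?thesis
      by (intro exI[of _ "[?e]"]) (auto simp: finite_path_Cons sync_lambda_graph_simps)
  next
    case False
    with Cons.IH[of "Suc l"] Cons.prems wv obtain es
      where "finite_path ?G es" "map (lab ?G) es = w" "src ?G (hd es) = vertex X (Suc l) (w @ v)"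
      by auto
    with e show ?thesis
      by (intro exI[of _ "?e # es"]) (auto simp: finite_path_Cons sync_lambda_graph_simps)
  qed
qed simp

lemma presents_sync_lambda_graph:
  assumes "lambda_synchronizing X"
  shows "presents (sync_lambda_graph X) X"
  unfolding presents_def
proof (intro subset_antisym subsetI)
  fix w assume w: "w \<in> language X"
  \<comment> \<open>The path will start at level 0, so \<open>v\<close> has to be synchronizing at
    level \<open>length w\<close>.\<close>
  then obtain v where "v \<in> sync_words X (0 + length w)" "w @ v \<in> language X"
    using assms unfolding lambda_synchronizing_def gamma_plus_def by fastforce
  with finite_path_exists[OF language_nonempty[OF w]]
  show "w \<in> {map (lab (sync_lambda_graph X)) es |es. finite_path (sync_lambda_graph X) es}"
    by blast
next
  fix w
  assume "w \<in> {map (lab (sync_lambda_graph X)) es |es. finite_path (sync_lambda_graph X) es}"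
  then obtain es where w: "w = map (lab (sync_lambda_graph X)) es"
    and path: "finite_path (sync_lambda_graph X) es"
    by blast
  from finite_path_source[OF path] obtain \<nu> where "w @ \<nu> \<in> language X"
    using w sync_words_language by blast
  moreover have "w \<noteq> []"
    using path by (simp add: w finite_path_def)
  ultimately show "w \<in> language X"
    by (rule language_prefix)
qed

theorem proposition3p2:
  fixes \<Sigma> :: "'a set" and X :: "(int \<Rightarrow> 'a) set"
  assumes "finite \<Sigma>"
    and "subshift \<Sigma> X"
    and "lambda_synchronizing X"
  shows "lambda_graph_system \<Sigma> (sync_lambda_graph X) \<and> presents (sync_lambda_graph X) X"
  using lambda_graph_system_sync_lambda_graph[OF assms] presents_sync_lambda_graph[OF assms(3)]
  by blast

end
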